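(* Let $A\in\mathbb{R}^{m\times n}$ with $2\le m<n$ be a matrix with nonzero columns. Suppose that one of the following conditions holds: (i) $\alpha(A)<\frac{1}{\mu(A)}$; (ii) $\alpha(A)\le\frac{1}{\mu(A)}$ and $\beta(A)<\alpha(A)$. Then $\mu^{(2)}(A)>0$ and $$\mathrm{Spark}(A)\ \ge\ 1+\frac{2\left[1-\alpha(A)\beta(A)\widetilde{\mu}(A)^2\right]}{\mu^{(2)}(A)\left\{\widetilde{\mu}(A)(\alpha(A)+\beta(A))+\sqrt{\left[\widetilde{\mu}(A)(\alpha(A)-\beta(A))\right]^2+4}\right\}},$$ where $\widetilde{\mu}(A):=\mu(A)-\mu^{(2)}(A)$.
   Context: For a matrix $M\in\mathbb{R}^{m\times n}$ with nonzero columns $c_1,\dots,c_n$, put $g_{ij}=\frac{|c_i^Tc_j|}{\|c_i\|_2\|c_j\|_2}$. The mutual coherence is $\mu(M)=\max_{i\ne j}g_{ij}$. The sub-mutual coherence is $\mu^{(2)}(M)=\max\{g_{ij}: i\ne j,\ g_{ij}<\mu(M)\}$, the second largest distinct value among the $g_{ij}$, $i\neq j$ (convention: $0$ if this set is empty). For $i=1,\dots,n$ let $\alpha_i(M)=|\{j: j\ne i,\ g_{ij}=\mu(M)\}|$. The coherence rank is $\alpha(M)=\max_{1\le i\le n}\alpha_i(M)$; let $i_0$ be an index with $\alpha_{i_0}(M)=\alpha(M)$; the sub-coherence rank is $\beta(M)=\max_{i\ne i_0}\alpha_i(M)$ (independent of the choice of $i_0$). $\mathrm{Spark}(M)$ is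 the smallest number of columns of $M$ that are linearly dependent. *)

theory Defs
  imports "HOL-Analysis.Analysis"
begin

definition col_corr :: "real^'n^'m \<Rightarrow> 'n \<Rightarrow> 'n \<Rightarrow> real" where
  "col_corr M i j = \<bar>column i M \<bullet> column j M\<bar> / (norm (column i M) * norm (column j M))"

text \<open>The maxima below range over sets that are nonempty as soon as the matrix has at least
  two columns; for a one-column matrix the values are unspecified.\<close>

definition mutual_coherence :: "real^'n^'m \<Rightarrow> real" where
  "mutual_coherence M = Max {col_corr M i j | i j. i \<noteq> j}"

definition sub_mutual_coherence :: "real^'n^'m \<Rightarrow> real" where
  "sub_mutual_coherence M =
     (let S = {col_corr M i j | i j. i \<noteq> j \<and> col_corr M i j < mutual_coherence M}
      in if S = {} then 0 else Max S)"

definition coherence_count :: "real^'n^'m \<Rightarrow> 'n \<Rightarrow> nat" where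
  "coherence_count M i = card {j. j \<noteq> i \<and> col_corr M i j = mutual_coherence M}"

definition coherence_rank :: "real^'n^'m \<Rightarrow> nat" where
  "coherence_rank M = Max (range (coherence_count M))"

text \<open>The index \<open>i0\<close> is an arbitrary maximiser; the value does not depend on it, see
  \<open>sub_coherence_rank_eq\<close> below.\<close>

definition sub_coherence_rank :: "real^'n^'m \<Rightarrow> nat" where
  "sub_coherence_rank M =
     (let i0 = (SOME i. coherence_count M i = coherence_rank M)
      in Max (coherence_count M ` {i. i \<noteq> i0}))"

text \<open>Columns are counted with their indices: equal columns at different positions form a
  dependent family, although the set of their values may be independent.\<close>

definition columns_dependent :: "real^'n^'m \<Rightarrow> 'n set \<Rightarrow> bool" where
  "columns_dependent M S \<longleftrightarrow>
     (\<exists>c. (\<exists>j\<in>S. c j \<noteq> 0) \<and> (\<Sum>j\<in>S. c j *\<^sub>R column j M) = 0)"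

text \<open>Unspecified when all columns together are linearly independent; not the case if there are
  more columns than rows.\<close>

definition spark :: "real^'n^'m \<Rightarrow> nat" where
  "spark M = (LEAST k. \<exists>S. card S = k \<and> columns_dependent M S)"

lemma sub_coherence_rank_eq:
  fixes M :: "real^'n^'m"
  assumes "coherence_count M i0 = coherence_rank M"
  shows "sub_coherence_rank M = Max (coherence_count M ` {i. i \<noteq> i0})"
proof -
  define k where "k = (SOME i. coherence_count M i = coherence_rank M)"
  have k: "coherence_count M k = coherence_rank M"
    unfolding k_def by (rule someI[of _ i0]) (rule assms)
  have "coherence_count M ` {i. i \<noteq> k} = coherence_count M ` {i. i \<noteq> i0}"
  proof (cases "k = i0")
    case False
    have "coherence_count M ` {i. i \<noteq> a} \<subseteq> coherence_count M ` {i. i \<noteq> b}"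
      if "a \<noteq> b" "coherence_count M a = coherence_count M b" for a b
    proof
      fix x assume "x \<in> coherence_count M ` {i. i \<noteq> a}"
      then obtain i where "i \<noteq> a" "x = coherence_count M i" by auto
      then show "x \<in> coherence_count M ` {i. i \<noteq> b}"
        using that by (cases "i = b") (auto intro: rev_image_eqI)
    qed
    from this[of k i0] this[of i0 k] show ?thesis using False k assms by auto
  qed simp
  then show ?thesis unfolding sub_coherence_rank_def Let_def k_def by simp
qed

lemma columns_dependent_iff:
  fixes M :: "real^'n^'m"
  shows "columns_dependent M S \<longleftrightarrow>
    \<not> inj_on (\<lambda>j. column j M) S \<or> dependent ((\<lambda>j. column j M) ` S)"
proof (cases "inj_on (\<lambda>j. column j M) S")
  case True
  let ?f = "\<lambda>j. column j M"
  have "dependent (?f ` S) \<longleftrightarrow>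
      (\<exists>u. (\<exists>v\<in>?f ` S. u v \<noteq> 0) \<and> (\<Sum>v\<in>?f ` S. u v *\<^sub>R v) = 0)"
    by (rule dependent_finite) simp
  also have "\<dots> \<longleftrightarrow> (\<exists>u. (\<exists>j\<in>S. u (?f j) \<noteq> 0) \<and> (\<Sum>j\<in>S. u (?f j) *\<^sub>R ?f j) = 0)"
    by (simp add: sum.reindex[OF True])
  also have "\<dots> \<longleftrightarrow> columns_dependent M S"
  proof
    assume "columns_dependent M S"
    then obtain c where c: "\<exists>j\<in>S. c j \<noteq> 0" "(\<Sum>j\<in>S. c j *\<^sub>R ?f j) = 0"
      unfolding columns_dependent_def by blast
    have inv: "inv_into S ?f (?f j) = j" if "j \<in> S" for j
      using True that by (rule inv_into_f_f)
    let ?u = "\<lambda>v. c (inv_into S ?f v)"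
    have "(\<Sum>j\<in>S. ?u (?f j) *\<^sub>R ?f j) = (\<Sum>j\<in>S. c j *\<^sub>R ?f j)"
      by (rule sum.cong) (simp_all add: inv)
    with c inv show "\<exists>u. (\<exists>j\<in>S. u (?f j) \<noteq> 0) \<and> (\<Sum>j\<in>S. u (?f j) *\<^sub>R ?f j) = 0"
      by (intro exI[of _ ?u]) auto
  next
    assume "\<exists>u. (\<exists>j\<in>S. u (?f j) \<noteq> 0) \<and> (\<Sum>j\<in>S. u (?f j) *\<^sub>R ?f j) = 0"
    then obtain u where "(\<exists>j\<in>S. u (?f j) \<noteq> 0) \<and> (\<Sum>j\<in>S. u (?f j) *\<^sub>R ?f j) = 0" by blast
    then show "columns_dependent M S"
      unfolding columns_dependent_def by (intro exI[of _ "\<lambda>j. u (?f j)"])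
  qed
  finally show ?thesis using True by simp
next
  case False
  then obtain a b where ab: "a \<in> S" "b \<in> S" "a \<noteq> b" "column a M = column b M"
    unfolding inj_on_def by blast
  let ?c = "\<lambda>j. (if j = a then 1 else 0) - (if j = b then 1 else (0::real))"
  have "(\<Sum>j\<in>S. ?c j *\<^sub>R column j M) =
      (\<Sum>j\<in>S. (if j = a then column j M else 0)) - (\<Sum>j\<in>S. (if j = b then column j M else 0))"
    unfolding sum_subtractf[symmetric] by (rule sum.cong) auto
  also have "\<dots> = 0" using ab by (simp add: sum.delta)
  finally have "columns_dependent M S"
    unfolding columns_dependent_def using ab by (intro exI[of _ ?c]) auto
  then show ?thesis using False by simp
qed

end

theory Submission
  imports Defs
begin

text \<open>Let \<open>\<Sum>j\<in>S. c j *\<^sub>R column j A = 0\<close> be a nontrivial relation with \<open>k = card S\<close>. Taking the inner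
  product with each column shows that the weights \<open>z j = \<bar>c j\<bar> * norm (column j A)\<close> satisfy
  \<open>z i \<le> (\<Sum>j\<in>S - {i}. g i j * z j)\<close>, where \<open>g\<close> is \<^const>\<open>col_corr\<close>
  (\<open>dependence_weight_le\<close>). Comparing the largest and the second largest weight, as in Brauer's
  theorem on the ovals of Cassini, gives two distinct indices \<open>p\<close>, \<open>q\<close> whose off-diagonal row sums
  have product at least 1 (\<open>cassini_pair\<close>).

  A row sum over \<open>S - {i}\<close> has \<open>k - 1\<close> entries, of which at most \<open>coherence_count A i\<close> equal \<open>\<mu>\<close>,
  while all others are at most \<open>\<mu>2\<close>; so it is bounded by
  \<open>(k - 1) * \<mu>2 + coherence_count A i * (\<mu> - \<mu>2)\<close> (\<open>corr_sum_le\<close>). As \<open>p \<noteq> q\<close>, one of the two counts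
  is at most \<open>\<alpha>\<close> and the other at most \<open>\<beta>\<close>. With \<open>x = (k - 1) * \<mu>2\<close>, \<open>a = \<alpha> * (\<mu> - \<mu>2)\<close> and
  \<open>b = \<beta> * (\<mu> - \<mu>2)\<close> this reads \<open>1 \<le> (x + a) * (x + b)\<close> (\<open>dependent_columns_product\<close>).

  If \<open>\<mu>2\<close> were 0, this would say \<open>1 \<le> (\<alpha> * \<mu>) * (\<beta> * \<mu>)\<close>, which both hypotheses exclude. Otherwise
  \<open>x\<close> is at least the larger root \<open>r\<close> of \<open>(r + a) * (r + b) = 1\<close>, and rationalising the formula for
  \<open>r\<close> gives the bound (\<open>quadratic_root_bound\<close>). A dependent family exists because there are
  more columns than rows, so the bound applies to one with \<open>k = spark A\<close>.\<close>

section \<open>Comparison of the two largest weights\<close>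

text \<open>If \<open>z p\<close> is the largest weight and \<open>z q\<close> the largest among the others, the hypothesis for \<open>p\<close>
  gives \<open>z p \<le> r p * z q\<close> and the one for \<open>q\<close> gives \<open>z q \<le> r q * z p\<close>, with \<open>r\<close> the row sums;
  the weights cancel from the product of the two.\<close>

lemma cassini_pair:
  fixes g :: "'a \<Rightarrow> 'a \<Rightarrow> real" and z :: "'a \<Rightarrow> real"
  assumes "finite S" and g: "\<And>i j. 0 \<le> g i j" and z: "\<And>i. 0 \<le> z i"
    and j0: "j0 \<in> S" "0 < z j0"
    and dom: "\<And>i. i \<in> S \<Longrightarrow> z i \<le> (\<Sum>j\<in>S - {i}. g i j * z j)"
  obtains p q where "p \<in> S" "q \<in> S" "p \<noteq> q"
    "1 \<le> (\<Sum>j\<in>S - {p}. g p j) * (\<Sum>j\<in>S - {q}. g q j)"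
proof -
  obtain p where p: "p \<in> S" "\<And>j. j \<in> S \<Longrightarrow> z j \<le> z p"
    using Max_in[of "z ` S"] Max_ge[of "z ` S"] \<open>finite S\<close> j0(1) by fastforce
  have zp: "0 < z p" using p(2)[OF j0(1)] j0(2) by simp
  have "S - {p} \<noteq> {}" using dom[OF p(1)] zp by (metis not_le sum.empty)
  then obtain q where q: "q \<in> S - {p}" "\<And>j. j \<in> S - {p} \<Longrightarrow> z j \<le> z q"
    using Max_in[of "z ` (S - {p})"] Max_ge[of "z ` (S - {p})"] \<open>finite S\<close> by fastforce
  define r where "r i = (\<Sum>j\<in>S - {i}. g i j)" for i
  have r0: "0 \<le> r i" for i unfolding r_def by (simp add: g sum_nonneg)
  have "z p \<le> (\<Sum>j\<in>S - {p}. g p j * z q)"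
    using dom[OF p(1)] by (rule order_trans) (intro sum_mono mult_left_mono q(2) g)
  then have pq: "z p \<le> r p * z q" by (simp add: r_def sum_distrib_right)
  have "z q \<le> (\<Sum>j\<in>S - {q}. g q j * z p)"
    using q(1) by (intro order_trans[OF dom] sum_mono mult_left_mono p(2) g) auto
  then have "z q \<le> r q * z p" by (simp add: r_def sum_distrib_right)
  then have "r p * z q \<le> r p * (r q * z p)" by (rule mult_left_mono[OF _ r0])
  with pq have "1 * z p \<le> (r p * r q) * z p" by (simp add: mult.assoc)
  then have "1 \<le> r p * r q" using zp by (metis mult_le_cancel_right_pos)
  then show ?thesis using that[of p q] p(1) q(1) by (auto simp: r_def)
qed

section \<open>Coherence of the columns\<close>

lemma exists_other_index:
  fixes i :: "'n::finite"
  assumes "2 \<le> CARD('n)"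
  shows "\<exists>j. j \<noteq> i"
proof (rule ccontr)
  assume "\<not> (\<exists>j. j \<noteq> i)"
  then have "(UNIV :: 'n set) = {i}" by auto
  then have "CARD('n) = card {i}" by (rule arg_cong)
  then show False using assms by simp
qed

lemma col_corr_nonneg: "0 \<le> col_corr M i j"
  by (simp add: col_corr_def)

lemma dependence_weight_le:
  fixes M :: "real^'n^'m"
  assumes nz: "\<And>j. column j M \<noteq> 0" and "i \<in> S"
    and rel: "(\<Sum>j\<in>S. c j *\<^sub>R column j M) = 0"
  shows "\<bar>c i\<bar> * norm (column i M) \<le>
    (\<Sum>j\<in>S - {i}. col_corr M i j * (\<bar>c j\<bar> * norm (column j M)))"
proof -
  let ?v = "\<lambda>j. column j M"
  have "0 = ?v i \<bullet> (\<Sum>j\<in>S. c j *\<^sub>R ?v j)" using rel by simp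
  also have "\<dots> = (\<Sum>j\<in>S. c j * (?v i \<bullet> ?v j))" by (simp add: inner_sum_right)
  also have "\<dots> = c i * (?v i \<bullet> ?v i) + (\<Sum>j\<in>S - {i}. c j * (?v i \<bullet> ?v j))"
    using \<open>i \<in> S\<close> by (simp add: sum.remove)
  finally have "\<bar>c i * (?v i \<bullet> ?v i)\<bar> = \<bar>\<Sum>j\<in>S - {i}. c j * (?v i \<bullet> ?v j)\<bar>" by linarith
  also have "\<dots> \<le> (\<Sum>j\<in>S - {i}. \<bar>c j * (?v i \<bullet> ?v j)\<bar>)" by (rule sum_abs)
  also have "\<dots> = (\<Sum>j\<in>S - {i}. col_corr M i j * (\<bar>c j\<bar> * norm (?v j))) * norm (?v i)"
    unfolding sum_distrib_right
    by (rule sum.cong) (use nz in \<open>simp_all add: col_corr_def abs_mult\<close>)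
  finally have "(\<bar>c i\<bar> * norm (?v i)) * norm (?v i)
      \<le> (\<Sum>j\<in>S - {i}. col_corr M i j * (\<bar>c j\<bar> * norm (?v j))) * norm (?v i)"
    by (simp add: abs_mult power2_norm_eq_inner[symmetric] power2_eq_square mult.assoc)
  then show ?thesis by (rule mult_right_le_imp_le) (simp add: nz)
qed

lemma finite_corr: "finite {col_corr M i j | i j. P i j}"
  for M :: "real^'n^'m"
  by (rule finite_subset[of _ "(\<lambda>(i, j). col_corr M i j) ` UNIV"]) auto

lemma col_corr_le_mutual_coherence:
  fixes M :: "real^'n^'m"
  assumes "i \<noteq> j"
  shows "col_corr M i j \<le> mutual_coherence M"
  unfolding mutual_coherence_def by (rule Max_ge[OF finite_corr]) (use assms in blast)

lemma col_corr_le_sub_mutual_coherence: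
  fixes M :: "real^'n^'m"
  assumes "i \<noteq> j" "col_corr M i j \<noteq> mutual_coherence M"
  shows "col_corr M i j \<le> sub_mutual_coherence M"
proof -
  let ?S = "{col_corr M i j | i j. i \<noteq> j \<and> col_corr M i j < mutual_coherence M}"
  have mem: "col_corr M i j \<in> ?S"
    using assms col_corr_le_mutual_coherence[OF assms(1), of M] by fastforce
  then have "?S \<noteq> {}" by blast
  then have "sub_mutual_coherence M = Max ?S" unfolding sub_mutual_coherence_def Let_def
    by (rule if_not_P)
  then show ?thesis using Max_ge[OF finite_corr mem] by simp
qed

lemma sub_mutual_coherence_bounds:
  fixes M :: "real^'n^'m"
  assumes "2 \<le> CARD('n)"
  shows "0 \<le> sub_mutual_coherence M" "sub_mutual_coherence M \<le> mutual_coherence M"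
proof -
  let ?S = "{col_corr M i j | i j. i \<noteq> j \<and> col_corr M i j < mutual_coherence M}"
  obtain i j :: 'n where "i \<noteq> j" using exists_other_index[OF assms] by blast
  then have \<mu>: "0 \<le> mutual_coherence M"
    using col_corr_le_mutual_coherence[of i j M] col_corr_nonneg[of M i j] by linarith
  have "0 \<le> sub_mutual_coherence M \<and> sub_mutual_coherence M \<le> mutual_coherence M"
  proof (cases "?S = {}")
    case True
    then have "sub_mutual_coherence M = 0" unfolding sub_mutual_coherence_def Let_def
      by (rule if_P)
    then show ?thesis using \<mu> by simp
  next
    case False
    then have "sub_mutual_coherence M = Max ?S" unfolding sub_mutual_coherence_def Let_def
      by (rule if_not_P)
    with Max_in[OF finite_corr False] have "sub_mutual_coherence M \<in> ?S" by simp
    then show ?thesis using col_corr_nonneg[of M] by fastforce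
  qed
  then show "0 \<le> sub_mutual_coherence M" "sub_mutual_coherence M \<le> mutual_coherence M" by auto
qed

text \<open>Every entry contributes at most \<^term>\<open>sub_mutual_coherence M\<close>, and each of the at most
  \<^term>\<open>coherence_count M i\<close> entries of maximal value an additional
  \<^term>\<open>mutual_coherence M - sub_mutual_coherence M\<close>. The count is taken over all columns, so
  this uses that the additional amount is nonnegative.\<close>

lemma corr_sum_le:
  fixes M :: "real^'n^'m"
  assumes "2 \<le> CARD('n)" and "i \<in> S"
  shows "(\<Sum>j\<in>S - {i}. col_corr M i j) \<le>
    (real (card S) - 1) * sub_mutual_coherence M
      + real (coherence_count M i) * (mutual_coherence M - sub_mutual_coherence M)"
proof -
  let ?\<mu> = "mutual_coherence M" and ?\<mu>2 = "sub_mutual_coherence M"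
  let ?N = "{j. j \<noteq> i \<and> col_corr M i j = ?\<mu>}"
  have "(\<Sum>j\<in>S - {i}. col_corr M i j) \<le> (\<Sum>j\<in>S - {i}. ?\<mu>2 + (if j \<in> ?N then ?\<mu> - ?\<mu>2 else 0))"
    by (rule sum_mono) (auto intro: col_corr_le_sub_mutual_coherence)
  also have "\<dots> = real (card (S - {i})) * ?\<mu>2 + real (card ((S - {i}) \<inter> ?N)) * (?\<mu> - ?\<mu>2)"
    by (simp only: sum.distrib sum.inter_restrict[OF finite, symmetric] sum_constant)
  also have "real (card (S - {i})) = real (card S) - 1"
    using \<open>i \<in> S\<close> by (metis card.remove finite add_diff_cancel_left' of_nat_Suc)
  also have "real (card ((S - {i}) \<inter> ?N)) * (?\<mu> - ?\<mu>2) \<le> real (card ?N) * (?\<mu> - ?\<mu>2)"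
    using sub_mutual_coherence_bounds(2)[OF assms(1), of M]
    by (intro mult_right_mono) (auto intro: card_mono)
  finally show ?thesis by (simp add: coherence_count_def)
qed

lemma coherence_count_le_rank: "coherence_count M i \<le> coherence_rank M"
  for M :: "real^'n^'m"
  unfolding coherence_rank_def by (rule Max_ge) auto

lemma coherence_rank_attained:
  fixes M :: "real^'n^'m"
  obtains i0 where "coherence_count M i0 = coherence_rank M"
  using Max_in[of "range (coherence_count M)"] unfolding coherence_rank_def by fastforce

lemma coherence_count_le_sub_rank:
  fixes M :: "real^'n^'m"
  assumes "coherence_count M i0 = coherence_rank M" "i \<noteq> i0"
  shows "coherence_count M i \<le> sub_coherence_rank M"
  unfolding sub_coherence_rank_eq[OF assms(1)] by (rule Max_ge) (use assms(2) in auto)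

lemma sub_coherence_rank_le_rank:
  fixes M :: "real^'n^'m"
  assumes "2 \<le> CARD('n)"
  shows "sub_coherence_rank M \<le> coherence_rank M"
proof -
  obtain i0 where i0: "coherence_count M i0 = coherence_rank M" by (rule coherence_rank_attained)
  have "{i. i \<noteq> i0} \<noteq> {}" using exists_other_index[OF assms] by simp
  then show ?thesis unfolding sub_coherence_rank_eq[OF i0]
    by (intro Max.boundedI) (auto intro: coherence_count_le_rank)
qed

section \<open>Dependent families of columns\<close>

lemma columns_dependent_UNIV:
  fixes M :: "real^'n^'m"
  assumes "CARD('m) < CARD('n)"
  shows "columns_dependent M UNIV"
proof (rule ccontr)
  let ?C = "range (\<lambda>j. column j M)"
  assume "\<not> columns_dependent M UNIV"
  then have "inj (\<lambda>j. column j M)" "independent ?C" by (auto simp: columns_dependent_iff)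
  then have "CARD('n) \<le> DIM(real^'m)"
    using independent_bound[of ?C] by (simp add: card_image)
  then show False using assms by simp
qed

lemma dependent_columns_product:
  fixes M :: "real^'n^'m"
  assumes n: "2 \<le> CARD('n)" and nz: "\<And>j. column j M \<noteq> 0" and dep: "columns_dependent M S"
  defines "x \<equiv> (real (card S) - 1) * sub_mutual_coherence M"
    and "t \<equiv> mutual_coherence M - sub_mutual_coherence M"
  shows "0 \<le> x" and "1 \<le> (x + real (coherence_rank M) * t) * (x + real (sub_coherence_rank M) * t)"
proof -
  obtain c j0 where c: "j0 \<in> S" "c j0 \<noteq> 0" "(\<Sum>j\<in>S. c j *\<^sub>R column j M) = 0"
    using dep unfolding columns_dependent_def by blast
  obtain p q where pq: "p \<in> S" "q \<in> S" "p \<noteq> q"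
    "1 \<le> (\<Sum>j\<in>S - {p}. col_corr M p j) * (\<Sum>j\<in>S - {q}. col_corr M q j)"
    by (rule cassini_pair[of S "col_corr M" "\<lambda>j. \<bar>c j\<bar> * norm (column j M)" j0])
      (use c nz in \<open>auto intro: dependence_weight_le col_corr_nonneg\<close>)
  have t: "0 \<le> t" using sub_mutual_coherence_bounds(2)[OF n, of M] by (simp add: t_def)
  have "1 \<le> card S" using c(1) by (simp add: Suc_le_eq card_gt_0_iff) blast
  then show x: "0 \<le> x" using sub_mutual_coherence_bounds(1)[OF n, of M] by (simp add: x_def)
  have le: "(\<Sum>j\<in>S - {i}. col_corr M i j) \<le> x + real (coherence_count M i) * t" if "i \<in> S" for i
    using corr_sum_le[OF n that, of M] by (simp add: x_def t_def)
  have le_counts: "1 \<le> (x + real (coherence_count M p) * t) * (x + real (coherence_count M q) * t)"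
    using pq(4) by (rule order_trans)
      (intro mult_mono le pq sum_nonneg col_corr_nonneg add_nonneg_nonneg x mult_nonneg_nonneg t
        of_nat_0_le_iff)
  have bound: "1 \<le> (x + real k * t) * (x + real l * t)"
    if "coherence_count M p \<le> k" "coherence_count M q \<le> l" for k l
    using le_counts by (rule order_trans)
      (use that x t in \<open>auto intro!: mult_mono add_left_mono mult_right_mono\<close>)
  \<comment> \<open>At most one of \<open>p\<close>, \<open>q\<close> is the chosen maximiser \<open>i0\<close>; the count of the other is bounded
    by the sub-coherence rank.\<close>
  obtain i0 where i0: "coherence_count M i0 = coherence_rank M" by (rule coherence_rank_attained)
  show "1 \<le> (x + real (coherence_rank M) * t) * (x + real (sub_coherence_rank M) * t)"
  proof (cases "p = i0")
    case True
    with pq(3) show ?thesis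
      by (intro bound coherence_count_le_rank coherence_count_le_sub_rank[OF i0]) simp
  next
    case False
    then show ?thesis
      by (subst mult.commute)
        (intro bound coherence_count_le_rank coherence_count_le_sub_rank[OF i0])
  qed
qed

section \<open>The bound on the spark\<close>

text \<open>With \<open>s\<close> the square root, \<open>4 * (1 - a * b) = (s - (a + b)) * (s + (a + b))\<close>, and the hypothesis
  says that \<open>s\<^sup>2 \<le> (2 * x + a + b)\<^sup>2\<close>, so the first factor is at most \<open>2 * x\<close>.\<close>

lemma quadratic_root_bound:
  fixes x a b :: real
  assumes "0 \<le> x" "0 \<le> a" "0 \<le> b" and le: "1 \<le> (x + a) * (x + b)"
  shows "2 * (1 - a * b) \<le> x * (a + b + sqrt ((a - b)\<^sup>2 + 4))"
proof -
  define s where "s = sqrt ((a - b)\<^sup>2 + 4)"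
  have s2: "s\<^sup>2 = (a - b)\<^sup>2 + 4" and s0: "0 \<le> s" by (simp_all add: s_def)
  have "s\<^sup>2 \<le> (2 * x + a + b)\<^sup>2" unfolding s2 using le by (simp add: power2_eq_square algebra_simps)
  then have "s - (a + b) \<le> 2 * x" using power2_le_imp_le[of s "2 * x + a + b"] assms by simp
  then have "(s - (a + b)) * (s + (a + b)) \<le> 2 * x * (s + (a + b))"
    using s0 assms by (intro mult_right_mono) auto
  moreover have "(s - (a + b)) * (s + (a + b)) = 4 * (1 - a * b)"
    using s2 by (simp add: power2_eq_square algebra_simps)
  ultimately show ?thesis unfolding s_def[symmetric] by (simp add: algebra_simps)
qed

theorem theorem2p5:
  fixes A :: "real^'n^'m" and \<mu> \<mu>2 \<mu>t \<alpha> \<beta> :: real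
  defines "\<mu> \<equiv> mutual_coherence A"
    and "\<mu>2 \<equiv> sub_mutual_coherence A"
    and "\<alpha> \<equiv> real (coherence_rank A)"
    and "\<beta> \<equiv> real (sub_coherence_rank A)"
    and "\<mu>t \<equiv> \<mu> - \<mu>2"
  assumes "2 \<le> CARD('m)" and "CARD('m) < CARD('n)"
    and "\<And>j. column j A \<noteq> 0"
    and "\<alpha> < 1 / \<mu> \<or> (\<alpha> \<le> 1 / \<mu> \<and> \<beta> < \<alpha>)"
  shows "\<mu>2 > 0 \<and>
    real (spark A) \<ge> 1 + 2 * (1 - \<alpha> * \<beta> * \<mu>t\<^sup>2) /
      (\<mu>2 * (\<mu>t * (\<alpha> + \<beta>) + sqrt ((\<mu>t * (\<alpha> - \<beta>))\<^sup>2 + 4)))"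
proof -
  have n: "2 \<le> CARD('n)" using assms(6,7) by simp
  have "\<exists>k S. card S = k \<and> columns_dependent A S"
    using columns_dependent_UNIV[OF assms(7)] by blast
  from LeastI_ex[OF this] obtain S where S: "card S = spark A" "columns_dependent A S"
    unfolding spark_def by blast
  define x where "x = (real (spark A) - 1) * \<mu>2"
  have x0: "0 \<le> x" and prod: "1 \<le> (x + \<alpha> * \<mu>t) * (x + \<beta> * \<mu>t)"
    using dependent_columns_product[OF n assms(8) S(2)]
    unfolding x_def \<mu>_def \<mu>2_def \<mu>t_def \<alpha>_def \<beta>_def S(1) by simp_all
  have \<mu>2: "0 \<le> \<mu>2" "\<mu>2 \<le> \<mu>"
    using sub_mutual_coherence_bounds[OF n, of A] by (simp_all add: \<mu>_def \<mu>2_def)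
  have \<alpha>\<beta>: "0 \<le> \<beta>" "\<beta> \<le> \<alpha>"
    using sub_coherence_rank_le_rank[OF n, of A] by (simp_all add: \<alpha>_def \<beta>_def)
  have t0: "0 \<le> \<mu>t" using \<mu>2(2) by (simp add: \<mu>t_def)
  have pos: "0 < \<mu>2"
  proof (rule ccontr)
    assume "\<not> 0 < \<mu>2"
    then have "\<mu>2 = 0" using \<mu>2(1) by simp
    then have one: "1 \<le> (\<alpha> * \<mu>) * (\<beta> * \<mu>)" using prod by (simp add: x_def \<mu>t_def)
    then have "\<mu> \<noteq> 0" by auto
    then have \<mu>: "0 < \<mu>" using \<mu>2 by simp
    have "\<alpha> * \<mu> \<le> 1" and "\<beta> * \<mu> < 1"
    proof -
      show "\<alpha> * \<mu> \<le> 1" using assms(9) \<mu> by (auto simp: pos_less_divide_eq pos_le_divide_eq)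
      have "\<beta> < 1 / \<mu>" using assms(9) \<alpha>\<beta>(2) by linarith
      then show "\<beta> * \<mu> < 1" using \<mu> by (simp add: pos_less_divide_eq)
    qed
    moreover have "(\<alpha> * \<mu>) * (\<beta> * \<mu>) \<le> 1 * (\<beta> * \<mu>)"
      using \<open>\<alpha> * \<mu> \<le> 1\<close> \<alpha>\<beta> \<mu> by (intro mult_right_mono) auto
    ultimately show False using one by linarith
  qed
  define D where "D = \<mu>t * (\<alpha> + \<beta>) + sqrt ((\<mu>t * (\<alpha> - \<beta>))\<^sup>2 + 4)"
  have D: "0 < D" unfolding D_def
    using t0 \<alpha>\<beta> by (intro add_nonneg_pos mult_nonneg_nonneg real_sqrt_gt_zero add_nonneg_pos) auto
  have "2 * (1 - (\<alpha> * \<mu>t) * (\<beta> * \<mu>t))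
      \<le> x * (\<alpha> * \<mu>t + \<beta> * \<mu>t + sqrt ((\<alpha> * \<mu>t - \<beta> * \<mu>t)\<^sup>2 + 4))"
    using x0 prod t0 \<alpha>\<beta> by (intro quadratic_root_bound) auto
  also have "\<dots> = x * D" by (simp add: D_def algebra_simps)
  finally have "2 * (1 - \<alpha> * \<beta> * \<mu>t\<^sup>2) \<le> (real (spark A) - 1) * (\<mu>2 * D)"
    by (simp add: x_def power2_eq_square mult_ac)
  then have "2 * (1 - \<alpha> * \<beta> * \<mu>t\<^sup>2) / (\<mu>2 * D) \<le> real (spark A) - 1"
    using pos D by (simp add: pos_divide_le_eq)
  then show ?thesis using pos by (simp add: D_def)
qed

end
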